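(* For every positive integer $n$, $\mathrm{ex}^*(n, P_5) \leq 4n$.
   Context: An edge-coloring is proper if any two edges sharing a vertex receive different colors. An edge-colored subgraph is rainbow if no two of its edges have the same color. $P_5$ denotes the path with $5$ edges ($6$ vertices). $\mathrm{ex}^*(n,F)$ is the maximum number of edges in an $n$-vertex simple graph with a proper edge-coloring containing no rainbow copy of $F$. *)

theory Defs
  imports Main
begin

type_synonym 'a graph = "'a set \<times> 'a set set"

abbreviation verts :: "'a graph \<Rightarrow> 'a set" where "verts \<equiv> fst"
abbreviation edges :: "'a graph \<Rightarrow> 'a set set" where "edges \<equiv> snd"

definition simple_graph :: "'a graph \<Rightarrow> bool" where
  "simple_graph G \<longleftrightarrow> finite (verts G) \<and> (\<forall>e\<in>edges G. e \<subseteq> verts G \<and> card e = 2)"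

definition subgraph :: "'a graph \<Rightarrow> 'a graph \<Rightarrow> bool" where
  "subgraph H G \<longleftrightarrow> simple_graph H \<and> verts H \<subseteq> verts G \<and> edges H \<subseteq> edges G"

definition graph_iso :: "'a graph \<Rightarrow> 'b graph \<Rightarrow> bool" where
  "graph_iso F H \<longleftrightarrow>
     (\<exists>f. bij_betw f (verts F) (verts H) \<and> edges H = (\<lambda>e. f ` e) ` edges F)"

definition proper_edge_colouring :: "'a graph \<Rightarrow> ('a set \<Rightarrow> 'c) \<Rightarrow> bool" where
  "proper_edge_colouring G c \<longleftrightarrow>
     (\<forall>e\<in>edges G. \<forall>e'\<in>edges G. e \<noteq> e' \<and> e \<inter> e' \<noteq> {} \<longrightarrow> c e \<noteq> c e')"

definition rainbow :: "('a set \<Rightarrow> 'c) \<Rightarrow> 'a graph \<Rightarrow> bool" where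
  "rainbow c H \<longleftrightarrow> inj_on c (edges H)"

definition has_rainbow_copy :: "'b graph \<Rightarrow> 'a graph \<Rightarrow> ('a set \<Rightarrow> 'c) \<Rightarrow> bool" where
  "has_rainbow_copy F G c \<longleftrightarrow> (\<exists>H. subgraph H G \<and> graph_iso F H \<and> rainbow c H)"

text \<open>
  Vertices and colours are natural numbers here, so that all graphs range over one fixed type.
  This loses no generality: see \<open>card_edges_le_ex_star\<close> below.
\<close>

definition rainbow_free_sizes :: "nat \<Rightarrow> 'b graph \<Rightarrow> nat set" where
  "rainbow_free_sizes n F =
     {card (edges G) | (G :: nat graph) (c :: nat set \<Rightarrow> nat).
        simple_graph G \<and> card (verts G) = n \<and> proper_edge_colouring G c \<and>
        \<not> has_rainbow_copy F G c}"

definition ex_star :: "nat \<Rightarrow> 'b graph \<Rightarrow> nat" where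
  "ex_star n F = Max (rainbow_free_sizes n F)"

text \<open>The path is indexed by its number of edges, so it has \<open>k + 1\<close> vertices.\<close>

definition path_graph :: "nat \<Rightarrow> nat graph" where
  "path_graph k = ({0..k}, {{i, Suc i} | i. i < k})"

text \<open>
  The maximum in \<open>ex_star\<close> is over a finite set, which is nonempty as soon as the forbidden
  graph has an edge.
\<close>

lemma finite_edges:
  assumes "simple_graph G"
  shows "finite (edges G)"
proof (rule finite_subset)
  show "edges G \<subseteq> Pow (verts G)" using assms by (auto simp: simple_graph_def)
  show "finite (Pow (verts G))" using assms by (simp add: simple_graph_def)
qed

lemma finite_rainbow_free_sizes: "finite (rainbow_free_sizes n F)"
proof (rule finite_subset)
  show "rainbow_free_sizes n F \<subseteq> {0..2 ^ n}"
  proof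
    fix m assume "m \<in> rainbow_free_sizes n F"
    then obtain G :: "nat graph" where G: "simple_graph G" "card (verts G) = n" "m = card (edges G)"
      by (auto simp: rainbow_free_sizes_def)
    have "edges G \<subseteq> Pow (verts G)" "finite (verts G)"
      using G(1) by (auto simp: simple_graph_def)
    then have "card (edges G) \<le> card (Pow (verts G))"
      by (intro card_mono) auto
    then show "m \<in> {0..2 ^ n}" using G \<open>finite (verts G)\<close> by (simp add: card_Pow)
  qed
qed simp

lemma rainbow_free_sizes_nonempty:
  assumes "edges F \<noteq> {}"
  shows "rainbow_free_sizes n F \<noteq> {}"
proof -
  let ?G = "({..<n}, {}) :: nat graph"
  have "\<not> has_rainbow_copy F ?G (\<lambda>_. 0 :: nat)"
    using assms by (auto simp: has_rainbow_copy_def subgraph_def graph_iso_def)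
  moreover have "simple_graph ?G" "card (verts ?G) = n" "proper_edge_colouring ?G (\<lambda>_. 0 :: nat)"
    by (auto simp: simple_graph_def proper_edge_colouring_def)
  ultimately show ?thesis unfolding rainbow_free_sizes_def by blast
qed

lemma card_edges_le_ex_star:
  fixes G :: "'a graph" and c :: "'a set \<Rightarrow> 'c" and F :: "'b graph"
  assumes G: "simple_graph G" "card (verts G) = n"
    and c: "proper_edge_colouring G c" "\<not> has_rainbow_copy F G c"
  shows "card (edges G) \<le> ex_star n F"
proof -
  have finV: "finite (verts G)" and E: "\<And>e. e \<in> edges G \<Longrightarrow> e \<subseteq> verts G \<and> card e = 2"
    using G by (auto simp: simple_graph_def)
  obtain g :: "'a \<Rightarrow> nat" where g: "inj_on g (verts G)"
    using finite_imp_inj_to_nat_seg[OF finV] by metis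
  obtain h :: "'c \<Rightarrow> nat" where h: "inj_on h (c ` edges G)"
    using finite_imp_inj_to_nat_seg[OF finite_imageI[OF finite_edges[OF G(1)]]] by metis
  define g' where "g' = inv_into (verts G) g"
  define G' where "G' = (g ` verts G, (\<lambda>e. g ` e) ` edges G)"
  define c' where "c' = (\<lambda>e. h (c (g' ` e)))"
  have g'g: "g' ` g ` A = A" if "A \<subseteq> verts G" for A
    using that g by (simp add: g'_def inv_into_image_cancel)
  have inj_img: "inj_on (\<lambda>e. g ` e) (edges G)"
    using E g'g by (intro inj_on_inverseI[where g = "\<lambda>e. g' ` e"]) auto
  have cG: "card (edges G') = card (edges G)"
    by (simp add: G'_def card_image[OF inj_img])
  have "card (g ` e) = 2" if "e \<in> edges G" for e
    using E[OF that] card_image[OF inj_on_subset[OF g]] by auto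
  then have sG: "simple_graph G'"
    using finV E by (auto simp: simple_graph_def G'_def)
  have nG: "card (verts G') = n" using g G(2) by (simp add: G'_def card_image)
  have c'_eq: "c' (g ` e) = h (c e)" if "e \<in> edges G" for e
    using g'g E[OF that] by (simp add: c'_def)
  have pG: "proper_edge_colouring G' c'"
    unfolding proper_edge_colouring_def
  proof (intro ballI impI)
    fix x y assume x: "x \<in> edges G'" and y: "y \<in> edges G'" and xy: "x \<noteq> y \<and> x \<inter> y \<noteq> {}"
    from x y obtain e f where e: "e \<in> edges G" "x = g ` e" and f: "f \<in> edges G" "y = g ` f"
      by (auto simp: G'_def)
    have "g ` (e \<inter> f) = g ` e \<inter> g ` f"
      using g E[OF e(1)] E[OF f(1)] by (intro inj_on_image_Int) auto
    then have "e \<noteq> f \<and> e \<inter> f \<noteq> {}" using xy e f by auto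
    then have "c e \<noteq> c f" using c(1) e f by (auto simp: proper_edge_colouring_def)
    then have "h (c e) \<noteq> h (c f)" using inj_onD[OF h] e f by blast
    then show "c' x \<noteq> c' y" using c'_eq e f by simp
  qed
  have rG: "\<not> has_rainbow_copy F G' c'"
  proof
    assume "has_rainbow_copy F G' c'"
    then obtain H f where H: "subgraph H G'" "rainbow c' H"
      and f: "bij_betw f (verts F) (verts H)" "edges H = (\<lambda>e. f ` e) ` edges F"
      by (auto simp: has_rainbow_copy_def graph_iso_def)
    have VH: "verts H \<subseteq> g ` verts G" and EH: "edges H \<subseteq> (\<lambda>e. g ` e) ` edges G"
      using H(1) by (auto simp: subgraph_def G'_def)
    define K where "K = (g' ` verts H, (\<lambda>e. g' ` e) ` edges H)"
    have inj': "inj_on g' (verts H)"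
      unfolding g'_def using VH by (rule inj_on_inv_into)
    have VK: "verts K \<subseteq> verts G" using VH g'g[of "verts G"] by (auto simp: K_def)
    have EK: "edges K \<subseteq> edges G"
    proof
      fix x assume "x \<in> edges K"
      then obtain e where "e \<in> edges G" "x = g' ` g ` e" using EH by (auto simp: K_def)
      then show "x \<in> edges G" using g'g E by auto
    qed
    have "simple_graph K"
      unfolding simple_graph_def
    proof (intro conjI ballI)
      show "finite (verts K)" using VK finV by (rule finite_subset)
      fix x assume x: "x \<in> edges K"
      then show "card x = 2" using EK E by blast
      show "x \<subseteq> verts K" using x H(1) by (auto simp: K_def subgraph_def simple_graph_def)
    qed
    then have "subgraph K G" using VK EK by (simp add: subgraph_def)
    moreover have "graph_iso F K"
      unfolding graph_iso_def
    proof (intro exI conjI)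
      show "bij_betw (g' \<circ> f) (verts F) (verts K)"
        using bij_betw_trans[OF f(1) inj_on_imp_bij_betw[OF inj']] by (simp add: K_def)
      show "edges K = (\<lambda>e. (g' \<circ> f) ` e) ` edges F"
        by (simp add: K_def f(2) image_image image_comp)
    qed
    moreover have "rainbow c K"
      unfolding rainbow_def
    proof (rule inj_onI)
      fix x y assume xy: "x \<in> edges K" "y \<in> edges K" and eq: "c x = c y"
      obtain a b where ab: "a \<in> edges H" "x = g' ` a" "b \<in> edges H" "y = g' ` b"
        using xy by (auto simp: K_def)
      then have "c' a = c' b" using eq by (simp add: c'_def)
      then have "a = b" using H(2) ab unfolding rainbow_def by (meson inj_onD)
      then show "x = y" using ab by simp
    qed
    ultimately show False using c(2) unfolding has_rainbow_copy_def by blast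
  qed
  have "card (edges G) \<in> rainbow_free_sizes n F"
    unfolding rainbow_free_sizes_def mem_Collect_eq
    by (intro exI[of _ G'] exI[of _ c'] conjI sG nG pG rG cG[symmetric])
  then show ?thesis
    unfolding ex_star_def by (intro Max_ge finite_rainbow_free_sizes)
qed

end

theory Submission
  imports Defs
begin

text \<open>
  In a minimal counterexample every degree is at least 5 and some vertex \<open>v\<close> has degree at least 9,
  so that \<open>v\<close> is not the end of a rainbow path with 4 edges. Hence every end \<open>x\<close> of a rainbow path
  \<open>v u w x\<close> has exactly 5 neighbours, among them \<open>v\<close> and \<open>u\<close>. Prolonging paths that start with the
  edge \<open>v x\<close> shows that every neighbour of \<open>x\<close> other than \<open>v\<close> is again such an end, and that its
  neighbours lie in the closed neighbourhood of \<open>x\<close>. So \<open>v\<close> separates the rest of this closed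
  neighbourhood from its other neighbours, and \<open>x w u v\<close> extends through \<open>v\<close> to a rainbow path with
  5 edges.
\<close>

section \<open>Greedy choice of neighbours\<close>

text \<open>\<open>N\<close> is total and will be empty off the graph; hence
  \<open>min_degree\<close> speaks only of vertices that have a neighbour.\<close>

locale rainbow_path_free =
  fixes N :: "'a \<Rightarrow> 'a set" and k :: "'a \<Rightarrow> 'a \<Rightarrow> 'c"
  assumes N_sym: "b \<in> N a \<Longrightarrow> a \<in> N b"
    and N_irrefl: "a \<notin> N a"
    and finite_N: "finite (N a)"
    and k_sym: "k a b = k b a"
    and proper: "\<lbrakk>b \<in> N a; d \<in> N a; k a b = k a d\<rbrakk> \<Longrightarrow> b = d"
    and min_degree: "b \<in> N a \<Longrightarrow> 5 \<le> card (N b)"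
    and no_rainbow: "\<lbrakk>distinct [a, b, d, e, f, g];
      b \<in> N a; d \<in> N b; e \<in> N d; f \<in> N e; g \<in> N f\<rbrakk>
      \<Longrightarrow> \<not> distinct [k a b, k b d, k d e, k e f, k f g]"
begin

text \<open>By \<open>proper\<close>, \<open>k a\<close> is injective on \<open>N a\<close>, so each
  colour in \<open>C\<close> accounts for at most one neighbour.\<close>

lemma N_subset_card:
  assumes "\<And>b. b \<in> N a \<Longrightarrow> b \<in> X \<or> k a b \<in> C" and "finite X" "finite C"
  shows "card (N a) \<le> card X + card C"
proof -
  let ?D = "{b \<in> N a. k a b \<in> C}"
  have "card ?D \<le> card C"
    using proper assms(3) by (intro card_inj_on_le[where f = "k a"]) (auto intro!: inj_onI)
  moreover have "card (N a) \<le> card (X \<union> ?D)"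
    using assms finite_N by (intro card_mono) auto
  ultimately show ?thesis
    using card_Un_le[of X ?D] by linarith
qed

text \<open>Used to extend paths greedily. \<open>xs\<close> and \<open>cs\<close> hold forbidden
  vertices and colours; as lists they may repeat entries, since their lengths still bound the
  exclusions.\<close>

lemma pick_neighbour:
  assumes "length xs + length cs < card (N a)"
  obtains b where "b \<in> N a" "b \<notin> set xs" "k a b \<notin> set cs"
proof -
  have "\<not> (\<forall>b\<in>N a. b \<in> set xs \<or> k a b \<in> set cs)"
    using N_subset_card[of a "set xs" "set cs"] assms card_length[of xs] card_length[of cs]
    by fastforce
  then show ?thesis using that by blast
qed

end

section \<open>Rainbow paths at a vertex of degree at least 9\<close>

locale rainbow_path_free_hub = rainbow_path_free +
  fixes v
  assumes degree_v: "9 \<le> card (N v)"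
begin

text \<open>This makes \<open>v u w x\<close> a rainbow path: the other vertices differ by
  \<open>N_irrefl\<close>, and the colours of consecutive edges by \<open>proper\<close>.\<close>

definition rainbow3 :: "'a \<Rightarrow> 'a \<Rightarrow> 'a \<Rightarrow> bool" where
  "rainbow3 u w x \<longleftrightarrow> u \<in> N v \<and> w \<in> N u \<and> x \<in> N w \<and> w \<noteq> v \<and> x \<noteq> v \<and> x \<noteq> u \<and> k w x \<noteq> k v u"

definition good :: "'a \<Rightarrow> bool" where
  "good x \<longleftrightarrow> (\<exists>u w. rainbow3 u w x)"

lemma ex_good: "\<exists>x. good x"
proof -
  obtain u where u: "u \<in> N v"
    using pick_neighbour[of "[]" "[]" v] degree_v by auto
  obtain w where w: "w \<in> N u" "w \<noteq> v"
    using pick_neighbour[of "[v]" "[]" u] min_degree[OF u] by auto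
  obtain x where "x \<in> N w" "x \<noteq> v" "x \<noteq> u" "k w x \<noteq> k v u"
    using pick_neighbour[of "[v, u]" "[k v u]" w] min_degree[OF w(1)] by auto
  then show ?thesis using u w by (auto simp: good_def rainbow3_def)
qed

lemma rainbow3_neighbours:
  assumes "rainbow3 u w x" and y: "y \<in> N x" "y \<notin> {v, u, w}"
  shows "k x y \<in> {k v u, k u w}"
proof (rule ccontr)
  assume col: "k x y \<notin> {k v u, k u w}"
  have r: "u \<in> N v" "w \<in> N u" "x \<in> N w" "w \<noteq> v" "x \<noteq> v" "x \<noteq> u" "k w x \<noteq> k v u"
    using assms(1) by (auto simp: rainbow3_def)
  \<comment> \<open>Four vertices and three colours exclude at most seven neighbours of
    \<open>v\<close>. The colour \<open>k v u\<close> is avoided because \<open>z\<close> differs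
    from \<open>u\<close>.\<close>
  obtain z where z: "z \<in> N v" "z \<notin> {u, w, x, y}" "k v z \<notin> {k u w, k w x, k x y}"
    using pick_neighbour[of "[u, w, x, y]" "[k u w, k w x, k x y]" v] degree_v by auto
  have ne: "k v u \<noteq> k u w" "k u w \<noteq> k w x" "k w x \<noteq> k x y" "k v z \<noteq> k v u"
    using proper[of v u w] proper[of u w x] proper[of w x y] proper[of z v u]
      r y z N_sym k_sym by (metis insertCI)+
  have "distinct [z, v, u, w, x, y]"
    using r y z N_irrefl by auto
  moreover have "distinct [k z v, k v u, k u w, k w x, k x y]"
    using ne r col z(3) k_sym[of z v] by auto
  ultimately show False
    using no_rainbow r y z N_sym by blast
qed

text \<open>At most three neighbours of \<open>x\<close> lie in \<open>{v, u, w}\<close> and at most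
  two outside it, one per colour, so degree at least 5 forces equality.\<close>

lemma rainbow3_end:
  assumes "rainbow3 u w x"
  shows "card (N x) = 5" "v \<in> N x" "u \<in> N x"
proof -
  have c: "card (N x) \<le> card (X \<inter> N x) + 2" if "X = {v, u, w}" for X
  proof -
    have "card (N x) \<le> card (X \<inter> N x) + card {k v u, k u w}"
      using rainbow3_neighbours[OF assms] that by (intro N_subset_card) auto
    also have "card {k v u, k u w} \<le> 2" by (simp add: card_insert_if)
    finally show ?thesis by simp
  qed
  have d: "5 \<le> card (N x)" using assms min_degree by (auto simp: rainbow3_def)
  have three: "card {v, u, w} \<le> 3" by (simp add: card_insert_if)
  have "card ({v, u, w} \<inter> N x) \<le> card {v, u, w}" by (intro card_mono) auto
  then have eq: "card ({v, u, w} \<inter> N x) = card {v, u, w}" and "card (N x) = 5"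
    using c[OF refl] d three by linarith+
  then show "card (N x) = 5" by simp
  have "{v, u, w} \<inter> N x = {v, u, w}"
    using eq by (intro card_subset_eq) auto
  then show "v \<in> N x" "u \<in> N x" by auto
qed

lemma good_card: "good x \<Longrightarrow> card (N x) = 5"
  and good_hub: "good x \<Longrightarrow> v \<in> N x"
  using rainbow3_end by (auto simp: good_def)

text \<open>A good \<open>x\<close> is adjacent to \<open>v\<close>, so \<open>rainbow3_end\<close>
  applies to the path \<open>v x a z\<close>, with \<open>x\<close> in the role of
  \<open>u\<close>.\<close>

lemma good_step:
  assumes "good x" "a \<in> N x" "a \<noteq> v" "z \<in> N a" "z \<notin> {v, x}" "k a z \<noteq> k v x"
  shows "good z" "z \<in> N x"
proof -
  have "rainbow3 x a z"
    using assms good_hub N_sym by (auto simp: rainbow3_def)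
  then show "good z" "z \<in> N x"
    using rainbow3_end N_sym by (auto simp: good_def)
qed

text \<open>The path \<open>v x r b\<close> makes \<open>b\<close> adjacent to \<open>x\<close>;
  then \<open>v x b r\<close>, with the last edge reversed, shows that \<open>r\<close> is
  good.\<close>

lemma good_neighbour:
  assumes "good x" "r \<in> N x" "r \<noteq> v"
  shows "good r"
proof -
  obtain b where b: "b \<in> N r" "b \<notin> {v, x}" "k r b \<noteq> k v x"
    using pick_neighbour[of "[v, x]" "[k v x]" r] min_degree[OF assms(2)] by auto
  have "b \<in> N x" using good_step[OF assms b] by simp
  moreover have "r \<noteq> x" using assms N_irrefl by blast
  ultimately show ?thesis
    using good_step(1)[of x b r] assms b N_sym k_sym by (metis empty_iff insert_iff)
qed

text \<open>Only an edge \<open>z y\<close> of colour \<open>k v x\<close> could leave the closed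
  neighbourhood. Then some edge \<open>y p\<close> with \<open>p\<close> in \<open>N x\<close> would
  have this colour too, against \<open>proper\<close> at \<open>y\<close>.\<close>

lemma good_closed:
  assumes x: "good x" and z: "z \<in> N x" "z \<noteq> v"
  shows "N z \<subseteq> insert x (N x)"
proof (rule ccontr)
  assume "\<not> N z \<subseteq> insert x (N x)"
  then obtain y where y: "y \<in> N z" "y \<noteq> x" "y \<notin> N x" by auto
  have gz: "good z" and yv: "y \<noteq> v"
    using good_neighbour[OF x z] good_hub[OF x] y by auto
  have zy: "k z y = k v x" using good_step(2)[OF x z y(1)] y yv by auto
  obtain p where p: "p \<in> N y" "p \<notin> {v, z}" "k y p \<noteq> k v z"
    using pick_neighbour[of "[v, z]" "[k v z]" y] min_degree[OF y(1)] by auto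
  \<comment> \<open>Here the path is \<open>v z y p\<close>, with the good vertex \<open>z\<close>
    next to \<open>v\<close>.\<close>
  have pz: "p \<in> N z" using good_step(2)[OF gz y(1) yv p] .
  have "p \<noteq> x" "p \<noteq> y" using y p N_sym N_irrefl by blast+
  then have "k z p \<noteq> k v x" using proper[OF pz y(1)] zy by auto
  then have "p \<in> N x"
    using good_step(2)[OF x z pz] p \<open>p \<noteq> x\<close> by auto
  then have "k p y = k v x"
    using good_step(2)[OF x, of p y] p y yv N_sym by auto
  then have "k y p = k y z" using zy k_sym by metis
  then have "p = z" using proper p(1) y(1) N_sym by blast
  then show False using p by simp
qed

lemma no_hub: False
proof -
  obtain x where x: "good x"
    using ex_good ..
  then obtain u w where r3: "rainbow3 u w x"
    by (auto simp: good_def)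
  have r: "u \<in> N v" "w \<in> N u" "x \<in> N w" "w \<noteq> v" "x \<noteq> v" "x \<noteq> u" "k w x \<noteq> k v u"
    using r3 by (auto simp: rainbow3_def)
  obtain xs where xs: "set xs = N x" "length xs = 5"
    using finite_distinct_list[OF finite_N[of x]] good_card[OF x] distinct_card by metis
  \<comment> \<open>\<open>x\<close>, its five neighbours and two colours exclude at most eight
    neighbours of \<open>v\<close>. Since \<open>u\<close> is in \<open>N x\<close>,
    \<open>s\<close> differs from \<open>u\<close>, hence \<open>k v s\<close> from
    \<open>k v u\<close>.\<close>
  obtain s where s: "s \<in> N v" "s \<notin> insert x (N x)" "k v s \<notin> {k u w, k w x}"
    using pick_neighbour[of "x # xs" "[k u w, k w x]" v] xs degree_v by auto
  obtain t where t: "t \<in> N s" "t \<noteq> v" "k s t \<notin> {k v u, k u w, k w x}"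
    using pick_neighbour[of "[v]" "[k v u, k u w, k w x]" s] min_degree[OF s(1)] by auto
  \<comment> \<open>Otherwise \<open>s\<close> would lie in the closed neighbourhood of
    \<open>x\<close> too, by \<open>good_closed\<close> or because \<open>t = x\<close>.\<close>
  have "t \<notin> insert x (N x)"
    using good_closed[OF x, of t] s t N_sym by blast
  moreover have ux: "u \<in> N x" "w \<in> N x" using rainbow3_end[OF r3] r N_sym by auto
  ultimately have "distinct [t, s, v, u, w, x]"
    using r s t N_irrefl by auto
  moreover have "k v u \<noteq> k u w" "k u w \<noteq> k w x" "k s t \<noteq> k v s" "k v s \<noteq> k v u"
    using proper[of v u w] proper[of u w x] proper[of v s t] proper[of s v u] r s t ux N_sym k_sym
    by (metis insertCI)+
  then have "distinct [k t s, k s v, k v u, k u w, k w x]"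
    using r s(3) t(3) k_sym[of t s] k_sym[of s v] by auto
  ultimately show False
    using no_rainbow r s t N_sym by blast
qed

end

section \<open>Transfer to graphs and induction on the number of vertices\<close>

lemma rainbow_path_5:
  assumes G: "simple_graph G"
    and d: "distinct [a, b, d, e, f, g]"
    and E: "{{a, b}, {b, d}, {d, e}, {e, f}, {f, g}} \<subseteq> edges G"
    and c: "distinct [c {a, b}, c {b, d}, c {d, e}, c {e, f}, c {f, g}]"
  shows "has_rainbow_copy (path_graph 5) G c"
proof -
  let ?p = "\<lambda>i. [a, b, d, e, f, g] ! i"
  let ?E = "{{a, b}, {b, d}, {d, e}, {e, f}, {f, g}}"
  let ?H = "({a, b, d, e, f, g}, ?E)"
  have V: "{a, b, d, e, f, g} \<subseteq> verts G"
    using G E by (auto simp: simple_graph_def)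
  have "simple_graph ?H"
    using d by (auto simp: simple_graph_def)
  then have "subgraph ?H G" using V E by (simp add: subgraph_def)
  moreover have "graph_iso (path_graph 5) ?H"
    unfolding graph_iso_def
  proof (intro exI conjI)
    have "{0..5} = {..<length [a, b, d, e, f, g]}" by auto
    then show "bij_betw ?p (verts (path_graph 5)) (verts ?H)"
      using bij_betw_nth[OF d] by (simp add: path_graph_def)
    have "{{i, Suc i} | i. i < 5} = (\<lambda>i. {i, Suc i}) ` {..<5}" by auto
    also have "{..<5::nat} = {0, 1, 2, 3, 4}" by auto
    finally show "edges ?H = (\<lambda>e. ?p ` e) ` edges (path_graph 5)"
      by (simp add: path_graph_def)
  qed
  moreover have "rainbow c ?H"
    using c by (auto simp: rainbow_def)
  ultimately show ?thesis unfolding has_rainbow_copy_def by blast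
qed

lemma card_neighbours:
  assumes "simple_graph G"
  shows "card {b. {a, b} \<in> edges G} = card {e \<in> edges G. a \<in> e}"
proof (rule bij_betw_same_card)
  have "\<exists>b. e = {a, b}" if "e \<in> edges G" "a \<in> e" for e
  proof -
    have "card e = 2" using assms that by (auto simp: simple_graph_def)
    then show ?thesis using \<open>a \<in> e\<close> by (auto simp: card_2_iff)
  qed
  then show "bij_betw (\<lambda>b. {a, b}) {b. {a, b} \<in> edges G} {e \<in> edges G. a \<in> e}"
    by (fastforce simp: bij_betw_def inj_on_def doubleton_eq_iff)
qed

lemma handshake:
  assumes "simple_graph G"
  shows "(\<Sum>a\<in>verts G. card {e \<in> edges G. a \<in> e}) = 2 * card (edges G)"
proof (rule sum_multicount)
  show "\<forall>e\<in>edges G. card {a \<in> verts G. a \<in> e} = 2"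
  proof
    fix e assume "e \<in> edges G"
    then have "e \<subseteq> verts G" "card e = 2" using assms by (auto simp: simple_graph_def)
    then show "card {a \<in> verts G. a \<in> e} = 2" by (simp add: Collect_conj_eq Int_absorb1)
  qed
qed (use assms finite_edges[OF assms] in \<open>auto simp: simple_graph_def\<close>)

lemma card_edges_le:
  assumes "simple_graph G" "proper_edge_colouring G c" "\<not> has_rainbow_copy (path_graph 5) G c"
  shows "card (edges G) \<le> 4 * card (verts G)"
  using assms
proof (induction "card (verts G)" arbitrary: G rule: less_induct)
  case less
  note G = less.prems(1) and col = less.prems(2) and free = less.prems(3)
  let ?deg = "\<lambda>a. card {e \<in> edges G. a \<in> e}"
  have fin: "finite (verts G)" "finite (edges G)"
    using G finite_edges[OF G] by (auto simp: simple_graph_def)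
  show ?case
  proof (cases "\<exists>a\<in>verts G. ?deg a \<le> 4")
    case True
    then obtain a where a: "a \<in> verts G" "?deg a \<le> 4" by auto
    \<comment> \<open>Deleting \<open>a\<close> loses at most four edges, the amount by which the
      bound drops.\<close>
    define H where "H = (verts G - {a}, {e \<in> edges G. a \<notin> e})"
    have H: "simple_graph H" "proper_edge_colouring H c"
      using G col by (auto simp: H_def simple_graph_def proper_edge_colouring_def)
    have "subgraph K G" if "subgraph K H" for K
      using that by (auto simp: subgraph_def H_def)
    then have "\<not> has_rainbow_copy (path_graph 5) H c"
      using free unfolding has_rainbow_copy_def by blast
    moreover have card_H: "card (verts G) = Suc (card (verts H))"
      using card.remove[OF fin(1) a(1)] by (simp add: H_def)
    ultimately have "card (edges H) \<le> 4 * card (verts H)"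
      using less.hyps H by auto
    moreover have "edges G = edges H \<union> {e \<in> edges G. a \<in> e}"
      by (auto simp: H_def)
    then have "card (edges G) \<le> card (edges H) + ?deg a"
      by (metis card_Un_le)
    ultimately show ?thesis using a(2) card_H by linarith
  next
    case False
    show ?thesis
    proof (rule ccontr)
      assume "\<not> ?thesis"
      then have large: "8 * card (verts G) < (\<Sum>a\<in>verts G. ?deg a)"
        using handshake[OF G] by linarith
      \<comment> \<open>The average degree exceeds 8.\<close>
      obtain v where v: "9 \<le> ?deg v"
      proof (rule ccontr)
        assume "\<not> thesis"
        then have "?deg a \<le> 8" for a using that[of a] by linarith
        then have "(\<Sum>a\<in>verts G. ?deg a) \<le> of_nat (card (verts G)) * 8"
          by (intro sum_bounded_above) auto
        then show False using large by simp
      qed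
      let ?N = "\<lambda>a. {b. {a, b} \<in> edges G}"
      have in_V: "a \<in> verts G" "b \<in> verts G" "a \<noteq> b" if "{a, b} \<in> edges G" for a b
        using that G by (auto simp: simple_graph_def)
      interpret rainbow_path_free_hub ?N "\<lambda>a b. c {a, b}" v
      proof
        show "a \<in> ?N b" if "b \<in> ?N a" for a b using that by (simp add: insert_commute)
        show "a \<notin> ?N a" for a using in_V(3)[of a a] by auto
        show "finite (?N a)" for a
          using in_V(2) by (intro finite_subset[OF _ fin(1)]) auto
        show "c {a, b} = c {b, a}" for a b by (simp add: insert_commute)
        show "b = d" if "b \<in> ?N a" "d \<in> ?N a" "c {a, b} = c {a, d}" for a b d
          using that col unfolding proper_edge_colouring_def
          by (metis (no_types, lifting) disjoint_iff doubleton_eq_iff insertI1 mem_Collect_eq)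
        show "5 \<le> card (?N b)" if "b \<in> ?N a" for a b
          using that False in_V(2)[of a b] by (force simp: card_neighbours[OF G])
        show "9 \<le> card (?N v)" using v by (simp add: card_neighbours[OF G])
        show "\<not> distinct [c {a, b}, c {b, d}, c {d, e}, c {e, f}, c {f, g}]"
          if "distinct [a, b, d, e, f, g]" "b \<in> ?N a" "d \<in> ?N b" "e \<in> ?N d" "f \<in> ?N e" "g \<in> ?N f"
          for a b d e f g
          using rainbow_path_5[OF G that(1)] that free by blast
      qed
      show False by (rule no_hub)
    qed
  qed
qed

theorem theorem11:
  fixes n :: nat
  assumes "n > 0"
  shows "ex_star n (path_graph 5) \<le> 4 * n"
proof -
  \<comment> \<open>The path has an edge, so the set of sizes is nonempty and its maximum is
    attained by a graph.\<close>
  have "edges (path_graph 5) \<noteq> {}" by (auto simp: path_graph_def intro: exI[of _ 0])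
  then have "ex_star n (path_graph 5) \<in> rainbow_free_sizes n (path_graph 5)"
    unfolding ex_star_def by (intro Max_in finite_rainbow_free_sizes rainbow_free_sizes_nonempty)
  then show ?thesis using card_edges_le by (auto simp: rainbow_free_sizes_def)
qed

end
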